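(* Let $n,m\ge 1$ and consider the generalized hitomezashi pattern (GHP) generated by binary strings $(x,y)$ with $x\in\{0,1\}^n$ and $y\in\{0,1\}^m$. Then: \begin{itemize} \item $\overline{R_D}$ is a symmetry of the GHP if and only if $n=m$ and $x=y^C$. \item $\overline{R_A}$ is a symmetry if and only if $n=m$ and: $x=y^{RC}$ when $n=m$ is even, and $x=y^R$ when $n=m$ is odd. \item $\overline{r_{90}}$ and $\overline{r_{270}}$ are symmetries if and only if $n=m$ is even and $x=x^R$, $y=y^R$, and $x=y^{RC}$ (this is an equivalence for each of $\overline{r_{90}}$ and $\overline{r_{270}}$). \item $\overline{r_{180}}$ is a symmetry if and only if one of the following is true: (i) $n$ and $m$ are even, $x=x^{RC}$ and $y=y^{RC}$; or (ii) $n$ and $m$ are odd, $x=x^R$ and $y=y^R$. \end{itemize}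
   Context: For a binary string $a=a_1\ldots a_n$: the reverse is $a^R=a_n\ldots a_1$, the complement is $a^C=(1-a_1)\ldots(1-a_n)$, and the reverse-complement is $a^{RC}=(1-a_n)\ldots(1-a_1)$. The GHP generated by $(x,y)$, $|x|=n$, $|y|=m$, is a stitched design on an $(n-1)\times(m-1)$ square grid: $x$ is read along the bottom and determines the $n$ vertical lines of stitches, $y$ is read up the left side and determines the $m$ horizontal lines of stitches. On each line, unit stitches alternate between the front and the back of the fabric; entry 1 (resp. 0) means the first stitch from the bottom/left is on the front (resp. back). The isometries considered are the elements of the symmetry group $D_4$ of a square: identity $e$, counterclockwise rotations $r_{90},r_{180},r_{270}$, reflections $R_H$ (across the horizontal midline), $R_V$ (across the vertical midline), $R_D$ (across the diagonal of slope $+1$), $R_A$ (across the diagonal of slope $-1$). Each acts on designs, and its effect on generating strings is: $R_H(x,y)=(x,y^R)$ if $m$ even, $(x^C,y^R)$ if $m$ odd; $R_V(x,y)=(x^R,y)$ if $n$ even, $(x^R,y^C)$ if $n$ odd; $R_D(x,y)=(y,x)$; $R_A(x,y)=(y^R,x^R)$ if $n$ even, $(y^{RC},x^{RC})$ if $n$ odd (with $n=m$); $r_{90}(x,y)=(y^R,x)$ if $m$ even, $(y^R,x^C)$ if $m$ odd; $r_{270}(x,y)=(y,x^R)$ if $n$ even, $(y^C,x^R)$ if $n$ odd; $r_{180}(x,y)=(x^R,y^R)$ if $n,m$ even; $(x^{RC},y^R)$ if $n$ even, $m$ odd; $(x^R,y^{RC})$ if $n$ odd, $m$ even; $(x^{RC},y^{RC})$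 if $n,m$ odd. The maps $R_D,R_A,r_{90},r_{270}$ can be symmetries only when $n=m$. Let $B(x,y)=(x^C,y^C)$ (exchange of front and back stitches). For an isometry $s\in D_4$ put $\overline{s}=B\circ s$ (a flip-isometry). A map $s$ or $\overline{s}$ is a symmetry of the GHP generated by $(x,y)$ if it sends $(x,y)$ to $(x,y)$. *)

theory Defs
  imports Main
begin

text \<open>
  Binary strings are lists of booleans, with \<open>True\<close> for 1 and \<open>False\<close> for 0. The reverse \<open>a\<^sup>R\<close> is
  \<open>rev a\<close>.
\<close>

type_synonym bstring = "bool list"

definition cpl :: "bstring \<Rightarrow> bstring" where
  "cpl a = map Not a"

definition rcpl :: "bstring \<Rightarrow> bstring" where
  "rcpl a = cpl (rev a)"

text \<open>The elements of the dihedral group of the square; rotations are counterclockwise.\<close>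

datatype d4 = E | R90 | R180 | R270
  | RH  \<comment> \<open>reflection across the horizontal midline\<close>
  | RV  \<comment> \<open>reflection across the vertical midline\<close>
  | RD  \<comment> \<open>reflection across the diagonal of slope \<open>+1\<close>\<close>
  | RA  \<comment> \<open>reflection across the diagonal of slope \<open>-1\<close>\<close>

text \<open>
  The effect of an isometry on the pair of generating strings of a generalized hitomezashi pattern.
  The clause for \<open>RA\<close> is meaningful only for \<open>length x = length y\<close>. Nothing is imposed otherwise:
  for \<open>RD\<close>, \<open>RA\<close>, \<open>R90\<close> and \<open>R270\<close> the image has its two lengths interchanged, so that a
  pair of strings of different lengths is never fixed.
\<close>

fun act :: "d4 \<Rightarrow> bstring \<times> bstring \<Rightarrow> bstring \<times> bstring" where
  "act E (x, y) = (x, y)"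
| "act RH (x, y) = (if even (length y) then (x, rev y) else (cpl x, rev y))"
| "act RV (x, y) = (if even (length x) then (rev x, y) else (rev x, cpl y))"
| "act RD (x, y) = (y, x)"
| "act RA (x, y) = (if even (length x) then (rev y, rev x) else (rcpl y, rcpl x))"
| "act R90 (x, y) = (if even (length y) then (rev y, x) else (rev y, cpl x))"
| "act R270 (x, y) = (if even (length x) then (y, rev x) else (cpl y, rev x))"
| "act R180 (x, y) =
     (if even (length x) then
        (if even (length y) then (rev x, rev y) else (rcpl x, rev y))
      else
        (if even (length y) then (rev x, rcpl y) else (rcpl x, rcpl y)))"

definition flip :: "bstring \<times> bstring \<Rightarrow> bstring \<times> bstring" where
  "flip = (\<lambda>(x, y). (cpl x, cpl y))"

definition flip_isometry :: "d4 \<Rightarrow> bstring \<times> bstring \<Rightarrow> bstring \<times> bstring" where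
  "flip_isometry s = flip \<circ> act s"

text \<open>
  A symmetry fixes the generating pair. This is finer than fixing the stitched design below when
  \<open>length x = 1\<close> or \<open>length y = 1\<close>: some lines then carry no stitch at all, and the design does not
  determine its generating strings.
\<close>

definition is_symmetry ::
  "(bstring \<times> bstring \<Rightarrow> bstring \<times> bstring) \<Rightarrow> bstring \<times> bstring \<Rightarrow> bool" where
  "is_symmetry f p \<longleftrightarrow> f p = p"


text \<open>
  The stitched design itself, and the proof that \<open>act\<close> and \<open>flip\<close> are the effect on generating
  strings of the geometric operations. With \<open>n = length x\<close> and \<open>m = length y\<close>, the grid points are
  the pairs \<open>(i, j)\<close> with \<open>i < n\<close> and \<open>j < m\<close>, a stitch is the set of its two endpoints, and a
  design is given by the set of its front stitches.
\<close>

type_synonym stitch = "(nat \<times> nat) set"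

definition stitches :: "nat \<Rightarrow> nat \<Rightarrow> stitch set" where
  "stitches n m =
     {{(i, j), (i, Suc j)} | i j. i < n \<and> Suc j < m} \<union>
     {{(i, j), (Suc i, j)} | i j. Suc i < n \<and> j < m}"

definition ghp :: "bstring \<times> bstring \<Rightarrow> stitch set" where
  "ghp = (\<lambda>(x, y).
     {{(i, j), (i, Suc j)} | i j. i < length x \<and> Suc j < length y \<and> (x ! i \<longleftrightarrow> even j)} \<union>
     {{(i, j), (Suc i, j)} | i j. Suc i < length x \<and> j < length y \<and> (y ! j \<longleftrightarrow> even i)})"

text \<open>
  An isometry on the points of an \<open>n \<times> m\<close> grid. For \<open>R90\<close>, \<open>R270\<close>, \<open>RD\<close> and \<open>RA\<close> the image is
  an \<open>m \<times> n\<close> grid, again with lower left corner \<open>(0, 0)\<close>.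
\<close>

fun pt :: "d4 \<Rightarrow> nat \<Rightarrow> nat \<Rightarrow> nat \<times> nat \<Rightarrow> nat \<times> nat" where
  "pt E n m (i, j) = (i, j)"
| "pt RH n m (i, j) = (i, m - 1 - j)"
| "pt RV n m (i, j) = (n - 1 - i, j)"
| "pt RD n m (i, j) = (j, i)"
| "pt RA n m (i, j) = (m - 1 - j, n - 1 - i)"
| "pt R90 n m (i, j) = (m - 1 - j, i)"
| "pt R270 n m (i, j) = (j, n - 1 - i)"
| "pt R180 n m (i, j) = (n - 1 - i, m - 1 - j)"

definition move :: "(nat \<times> nat \<Rightarrow> nat \<times> nat) \<Rightarrow> stitch set \<Rightarrow> stitch set" where
  "move f S = image f ` S"

lemma length_cpl [simp]: "length (cpl a) = length a"
  by (simp add: cpl_def)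

lemma cpl_nth [simp]: "i < length a \<Longrightarrow> cpl a ! i \<longleftrightarrow> \<not> a ! i"
  by (simp add: cpl_def)

lemma cpl_cpl [simp]: "cpl (cpl a) = a"
  by (simp add: cpl_def comp_def)

lemma rev_cpl: "rev (cpl a) = cpl (rev a)"
  by (simp add: cpl_def rev_map)

lemma move_move: "move f (move g S) = move (f \<circ> g) S"
  by (simp add: move_def image_comp)

lemma ghp_cases:
  assumes "e \<in> ghp (x, y)"
  obtains (V) i j where "e = {(i, j), (i, Suc j)}" "i < length x" "Suc j < length y"
      "x ! i \<longleftrightarrow> even j"
    | (H) i j where "e = {(i, j), (Suc i, j)}" "Suc i < length x" "j < length y"
      "y ! j \<longleftrightarrow> even i"
  using assms unfolding ghp_def by blast

lemma ghp_V:
  "\<lbrakk>i < length x; Suc j < length y; x ! i \<longleftrightarrow> even j\<rbrakk> \<Longrightarrow> {(i, j), (i, Suc j)} \<in> ghp (x, y)"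
  unfolding ghp_def by blast

lemma ghp_H:
  "\<lbrakk>Suc i < length x; j < length y; y ! j \<longleftrightarrow> even i\<rbrakk> \<Longrightarrow> {(i, j), (Suc i, j)} \<in> ghp (x, y)"
  unfolding ghp_def by blast

lemma ghp_RD: "ghp (y, x) = move (pt RD n m) (ghp (x, y))"
proof -
  have sub: "move (pt RD n m) (ghp (x, y)) \<subseteq> ghp (y, x)" for x y n m
    by (auto simp: move_def elim!: ghp_cases intro: ghp_V ghp_H)
  have "move (pt RD n m) (move (pt RD n m) (ghp (y, x))) = ghp (y, x)"
  proof -
    have "pt RD n m (pt RD n m p) = p" for p
      by (cases p) simp
    then show ?thesis
      by (simp add: move_def image_image)
  qed
  moreover have "move (pt RD n m) (move (pt RD n m) (ghp (y, x))) \<subseteq> move (pt RD n m) (ghp (x, y))"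
    using sub[of n m y x] unfolding move_def by (rule image_mono)
  ultimately show ?thesis
    using sub[of n m x y] by (simp only: subset_antisym)
qed

lemma ghp_RH: "ghp (act RH (x, y)) = move (pt RH (length x) (length y)) (ghp (x, y))"
proof -
  have sub: "move (pt RH (length x) (length y)) (ghp (x, y)) \<subseteq> ghp (act RH (x, y))" for x y
  proof
    fix e' assume "e' \<in> move (pt RH (length x) (length y)) (ghp (x, y))"
    then obtain e where e: "e \<in> ghp (x, y)" and e': "e' = pt RH (length x) (length y) ` e"
      by (auto simp: move_def)
    from e show "e' \<in> ghp (act RH (x, y))"
    proof (cases rule: ghp_cases)
      case (V i j)
      define k where "k = length y - 2 - j"
      have k: "length y - 1 - j = Suc k" "length y - 1 - Suc j = k" "length y = k + j + 2"
        using V by (auto simp: k_def)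
      have "e' = {(i, k), (i, Suc k)}"
        using V(1) k(1,2) by (auto simp: e')
      then show ?thesis
        using V k(3) by (auto intro!: ghp_V)
    next
      case (H i j)
      have "e' = {(i, length y - 1 - j), (Suc i, length y - 1 - j)}"
        using H(1) by (auto simp: e')
      then show ?thesis
        using H by (auto intro!: ghp_H simp: rev_nth)
    qed
  qed
  have id: "move (pt RH (length x) (length y)) (move (pt RH (length x) (length y)) (ghp p)) = ghp p"
    if "p = act RH (x, y)" for p
  proof -
    have "pt RH (length x) (length y) ` pt RH (length x) (length y) ` e = e" if "e \<in> ghp p" for e
      using that \<open>p = act RH (x, y)\<close>
      by (auto simp: image_iff split: if_splits elim!: ghp_cases)
    then show ?thesis
      by (simp add: move_def image_image)
  qed
  obtain x' y' where p: "act RH (x, y) = (x', y')"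
    by fastforce
  then have "act RH (x', y') = (x, y)" "length x' = length x" "length y' = length y"
    by (auto split: if_splits)
  with sub[of x' y'] have "move (pt RH (length x) (length y)) (ghp (x', y')) \<subseteq> ghp (x, y)"
    by (simp only:)
  then have "move (pt RH (length x) (length y)) (move (pt RH (length x) (length y)) (ghp (x', y')))
      \<subseteq> move (pt RH (length x) (length y)) (ghp (x, y))"
    unfolding move_def by (rule image_mono)
  then have "ghp (x', y') \<subseteq> move (pt RH (length x) (length y)) (ghp (x, y))"
    by (simp only: id[OF p[symmetric]])
  then show ?thesis
    using sub[of x y] unfolding p by (rule subset_antisym)
qed

lemma pt_comp:
  "pt RV n m = pt RD m n \<circ> (pt RH m n \<circ> pt RD n m)"
  "pt R90 n m = pt RV m n \<circ> pt RD n m"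
  "pt R270 n m = pt RD n m \<circ> pt RV n m"
  "pt R180 n m = pt RH n m \<circ> pt RV n m"
  "pt RA n m = pt RD n m \<circ> pt R180 n m"
  by (auto simp: fun_eq_iff)

lemma act_comp:
  "act RV p = act RD (act RH (act RD p))"
  "act R90 p = act RV (act RD p)"
  "act R270 p = act RD (act RV p)"
  "act R180 p = act RH (act RV p)"
  "length (fst p) = length (snd p) \<Longrightarrow> act RA p = act RD (act R180 p)"
  by (cases p; simp add: rcpl_def rev_cpl)+

text \<open>The action on strings describes the action on designs.\<close>

lemma ghp_act:
  assumes "s = RA \<Longrightarrow> length x = length y"
  shows "ghp (act s (x, y)) = move (pt s (length x) (length y)) (ghp (x, y))"
proof -
  let ?G = "\<lambda>s p. ghp (act s p) = move (pt s (length (fst p)) (length (snd p))) (ghp p)"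
  have E: "?G E p" for p
  proof -
    have "pt E n m = id" for n m
      by (auto simp: fun_eq_iff)
    then show ?thesis
      by (cases p) (simp add: move_def)
  qed
  have RD: "?G RD p" for p
    by (cases p) (simp add: ghp_RD[symmetric])
  have RH: "?G RH p" for p
    using ghp_RH by (cases p) (simp del: act.simps)
  have len: "length (fst (act RD p)) = length (snd p)" "length (snd (act RD p)) = length (fst p)"
    "length (fst (act RH p)) = length (fst p)" "length (snd (act RH p)) = length (snd p)"
    "length (fst (act RV p)) = length (fst p)" "length (snd (act RV p)) = length (snd p)"
    "length (fst (act R180 p)) = length (fst p)" "length (snd (act R180 p)) = length (snd p)"
    for p by (cases p; simp add: rcpl_def)+
  have RD': "ghp (act RD p) = move (pt RD n m) (ghp p)" for p n m
    by (cases p) (simp add: ghp_RD[symmetric])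
  have RV: "?G RV p" for p
    unfolding act_comp(1) pt_comp(1) move_move[symmetric]
    by (simp only: RD'[symmetric] RH[of "act RD p", unfolded len, symmetric])
  have R180: "?G R180 p" for p
    unfolding act_comp(4) pt_comp(4) move_move[symmetric]
    by (simp only: RV[symmetric] RH[of "act RV p", unfolded len, symmetric])
  have "?G s (x, y)"
  proof (cases s)
    case R90
    have "?G R90 (x, y)"
      unfolding act_comp(2) pt_comp(2) move_move[symmetric]
      by (simp only: RD'[symmetric] RV[of "act RD (x, y)", unfolded len, symmetric])
    then show ?thesis by (simp only: R90)
  next
    case R270
    have "?G R270 (x, y)"
      unfolding act_comp(3) pt_comp(3) move_move[symmetric]
      by (simp only: RD'[symmetric] RV[symmetric])
    then show ?thesis by (simp only: R270)
  next
    case RA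
    have "act RA (x, y) = act RD (act R180 (x, y))"
      using assms RA by (intro act_comp(5)) simp
    then have "?G RA (x, y)"
      unfolding pt_comp(5) move_move[symmetric]
      by (simp only: RD'[symmetric] R180[symmetric])
    then show ?thesis by (simp only: RA)
  qed (use E RD RH RV R180 in \<open>simp_all only:\<close>)
  then show ?thesis
    by simp
qed

lemma V_eq: "{(i, j), (i, Suc j)} = {(k, l), (k, Suc l)} \<longleftrightarrow> i = k \<and> j = l" for i j k l :: nat
  by (auto simp: doubleton_eq_iff)

lemma H_eq: "{(i, j), (Suc i, j)} = {(k, l), (Suc k, l)} \<longleftrightarrow> i = k \<and> j = l" for i j k l :: nat
  by (auto simp: doubleton_eq_iff)

lemma VH_neq: "{(i, j), (i, Suc j)} \<noteq> {(k, l), (Suc k, l)}" for i j k l :: nat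
  by (auto simp: doubleton_eq_iff)

lemma ghp_flip: "ghp (flip (x, y)) = stitches (length x) (length y) - ghp (x, y)"
proof -
  have 1: "ghp (flip (x, y)) \<subseteq> stitches (length x) (length y)"
    by (auto simp: ghp_def flip_def stitches_def)
  have 2: "ghp (flip (x, y)) \<inter> ghp (x, y) = {}"
  proof -
    have False if e: "e \<in> ghp (cpl x, cpl y)" and e': "e \<in> ghp (x, y)" for e
      using e
    proof (cases rule: ghp_cases)
      case (V i j)
      note V1 = this
      from e' show False
      proof (cases rule: ghp_cases)
        case (V k l)
        then have "i = k \<and> j = l" using V1(1) V_eq by metis
        then show False using V V1 by simp
      next
        case (H k l)
        then show False using V1(1) VH_neq by metis
      qed
    next
      case (H i j)
      note H1 = this
      from e' show False
      proof (cases rule: ghp_cases)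
        case (V k l)
        then show False using H1(1) VH_neq by metis
      next
        case (H k l)
        then have "i = k \<and> j = l" using H1(1) H_eq by metis
        then show False using H H1 by simp
      qed
    qed
    then show ?thesis
      by (auto simp: flip_def)
  qed
  have 3: "stitches (length x) (length y) \<subseteq> ghp (flip (x, y)) \<union> ghp (x, y)"
  proof
    fix e assume "e \<in> stitches (length x) (length y)"
    then consider
        (V) i j where "e = {(i, j), (i, Suc j)}" "i < length x" "Suc j < length y"
      | (H) i j where "e = {(i, j), (Suc i, j)}" "Suc i < length x" "j < length y"
      unfolding stitches_def by blast
    then show "e \<in> ghp (flip (x, y)) \<union> ghp (x, y)"
    proof cases
      case V
      then show ?thesis
        using ghp_V[of i x j y] ghp_V[of i "cpl x" j "cpl y"] by (auto simp: flip_def)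
    next
      case H
      then show ?thesis
        using ghp_H[of i x j y] ghp_H[of i "cpl x" j "cpl y"] by (auto simp: flip_def)
    qed
  qed
  show ?thesis
    using 1 2 3 by blast
qed

end

theory Submission imports Defs
begin

text \<open>Because \<open>flip\<close> is an involution, a flip-isometry fixes a pair exactly when
  the isometry sends the pair to its complement (\<open>is_symmetry_flip_isometry_iff\<close>).
  Comparing components gives two string equations for each parity case, and these are solved for one
  string. Some parity cases force a string of odd length to equal its own reverse-complement, which
  the middle bit forbids (\<open>even_length_if_eq_rcpl\<close>); this excludes odd sides for the
  quarter turns and mixed parities for the half turn.\<close>

lemma length_rcpl [simp]: "length (rcpl a) = length a"
  by (simp add: rcpl_def)

lemma rcpl_rcpl [simp]: "rcpl (rcpl a) = a"
  by (simp add: rcpl_def rev_cpl)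

text \<open>This and the next two lemmas bring the component equations into solved form.\<close>

lemma rev_eq_cpl_iff: "rev a = cpl b \<longleftrightarrow> a = rcpl b"
  by (metis rcpl_def rev_cpl rev_rev_ident)

lemma rcpl_eq_cpl_iff: "rcpl a = cpl b \<longleftrightarrow> a = rev b"
  by (metis cpl_cpl rcpl_def rev_rev_ident)

lemma cpl_eq_cpl_iff: "cpl a = cpl b \<longleftrightarrow> a = b"
  by (metis cpl_cpl)

lemma eq_rcpl_commute: "a = rcpl b \<longleftrightarrow> b = rcpl a"
  by (metis rcpl_rcpl)

text \<open>The middle bit of a string of odd length is fixed by reversal and changed by complement.\<close>

lemma even_length_if_eq_rcpl:
  assumes "a = rcpl a"
  shows "even (length a)"
proof (rule ccontr)
  assume "odd (length a)"
  then obtain k where k: "length a = 2 * k + 1"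
    by (rule oddE)
  then have "rcpl a ! k \<longleftrightarrow> \<not> a ! k"
    by (simp add: rcpl_def rev_nth)
  with assms show False
    by simp
qed

lemma is_symmetry_flip_isometry_iff:
  "is_symmetry (flip_isometry s) p \<longleftrightarrow> act s p = flip p"
proof -
  have "flip (flip q) = q" for q
    by (cases q) (simp add: flip_def)
  then show ?thesis
    unfolding is_symmetry_def flip_isometry_def comp_apply by metis
qed

lemma flip_RD_iff:
  "is_symmetry (flip_isometry RD) (x, y) \<longleftrightarrow> x = cpl y"
  by (auto simp: is_symmetry_flip_isometry_iff flip_def)

text \<open>In either parity the two component equations are equivalent, since \<open>rev\<close>
  and \<open>rcpl\<close> are involutions; one of them suffices.\<close>

lemma flip_RA_iff:
  "is_symmetry (flip_isometry RA) (x, y) \<longleftrightarrow> x = (if even (length x) then rcpl y else rev y)"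
proof -
  have "y = rev x \<longleftrightarrow> x = rev y"
    by (metis rev_rev_ident)
  then show ?thesis
    using eq_rcpl_commute[of x y]
    by (simp add: is_symmetry_flip_isometry_iff flip_def rev_eq_cpl_iff rcpl_eq_cpl_iff)
qed

text \<open>The left side is what a quarter turn yields on even sides. Equating the two expressions
  for \<open>x\<close> gives \<open>cpl y = rcpl y\<close>, so \<open>y\<close> is a palindrome, and
  hence so is its complement \<open>x\<close>.\<close>

lemma eq_rcpl_and_eq_cpl_iff:
  "x = rcpl y \<and> x = cpl y \<longleftrightarrow> x = rev x \<and> y = rev y \<and> x = rcpl y"
  by (metis cpl_cpl rcpl_def rev_cpl rev_rev_ident)

lemma flip_R90_iff:
  "is_symmetry (flip_isometry R90) (x, y) \<longleftrightarrow>
    even (length y) \<and> x = rev x \<and> y = rev y \<and> x = rcpl y"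
proof (cases "even (length y)")
  case True
  then show ?thesis
    using eq_rcpl_and_eq_cpl_iff[of x y] eq_rcpl_commute[of x y]
    by (simp add: is_symmetry_flip_isometry_iff flip_def rev_eq_cpl_iff)
next
  case False
  \<comment> \<open>For odd length the component equations read \<open>y = rcpl x\<close> and
    \<open>x = y\<close>, so \<open>y\<close> would be its own reverse-complement.\<close>
  then have "y \<noteq> rcpl y"
    using even_length_if_eq_rcpl by blast
  with False show ?thesis
    by (simp add: is_symmetry_flip_isometry_iff flip_def rev_eq_cpl_iff cpl_eq_cpl_iff) metis
qed

lemma flip_R270_iff:
  "is_symmetry (flip_isometry R270) (x, y) \<longleftrightarrow>
    even (length x) \<and> x = rev x \<and> y = rev y \<and> x = rcpl y"
proof (cases "even (length x)")
  case True
  then show ?thesis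
    using eq_rcpl_and_eq_cpl_iff[of y x] eq_rcpl_commute[of x y]
    by (simp add: is_symmetry_flip_isometry_iff flip_def rev_eq_cpl_iff) blast
next
  case False
  \<comment> \<open>Here the equations are \<open>x = y\<close> and \<open>x = rcpl y\<close>, with
    the same contradiction.\<close>
  then have "x \<noteq> rcpl x"
    using even_length_if_eq_rcpl by blast
  with False show ?thesis
    by (simp add: is_symmetry_flip_isometry_iff flip_def rev_eq_cpl_iff cpl_eq_cpl_iff)
qed

text \<open>The components decouple. When exactly one length is odd, the string of that length would
  have to equal its own reverse-complement.\<close>

lemma flip_R180_iff:
  "is_symmetry (flip_isometry R180) (x, y) \<longleftrightarrow>
    even (length x) \<and> even (length y) \<and> x = rcpl x \<and> y = rcpl y \<or>
    odd (length x) \<and> odd (length y) \<and> x = rev x \<and> y = rev y"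
  using even_length_if_eq_rcpl[of x] even_length_if_eq_rcpl[of y]
  by (simp add: is_symmetry_flip_isometry_iff flip_def rev_eq_cpl_iff rcpl_eq_cpl_iff) blast

theorem theorem3p5:
  fixes x y :: bstring and n m :: nat
  assumes "n \<ge> 1" and "m \<ge> 1" and "length x = n" and "length y = m"
  shows
    "(is_symmetry (flip_isometry RD) (x, y) \<longleftrightarrow> n = m \<and> x = cpl y) \<and>
     (is_symmetry (flip_isometry RA) (x, y) \<longleftrightarrow>
        n = m \<and> (even n \<longrightarrow> x = rcpl y) \<and> (odd n \<longrightarrow> x = rev y)) \<and>
     (is_symmetry (flip_isometry R90) (x, y) \<longleftrightarrow>
        n = m \<and> even n \<and> x = rev x \<and> y = rev y \<and> x = rcpl y) \<and>
     (is_symmetry (flip_isometry R270) (x, y) \<longleftrightarrow>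
        n = m \<and> even n \<and> x = rev x \<and> y = rev y \<and> x = rcpl y) \<and>
     (is_symmetry (flip_isometry R180) (x, y) \<longleftrightarrow>
        (even n \<and> even m \<and> x = rcpl x \<and> y = rcpl y) \<or>
        (odd n \<and> odd m \<and> x = rev x \<and> y = rev y))"
proof -
  \<comment> \<open>All three operations preserve length, so the string equations already entail
    \<open>n = m\<close>.\<close>
  have "x \<noteq> rcpl y" "x \<noteq> rev y" "x \<noteq> cpl y" if "n \<noteq> m"
    using that assms(3,4) by auto
  then show ?thesis
    unfolding flip_RD_iff flip_RA_iff flip_R90_iff flip_R270_iff flip_R180_iff assms(3,4)
    by (cases "n = m") simp_all
qed

end
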